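(* Assume that the sequence $\mathbf a=(a_n)_{n\ge1}$ of positive integers satisfies $\liminf_{n\to\infty}a_n=\infty$. Then for an arbitrary integer sequence $\mathbf b=(b_i)_1^\infty$ with $b_i\ge2$ for all $i$, the bubble group $\Gamma_{\mathbf a,\mathbf b}$ is amenable.
   Context: Let $\mathbf a=(a_1,a_2,\dots)$, $\mathbf b=(b_1,b_2,\dots)$ be integer sequences, $a_i\ge1$, $b_i\ge 2$. The bubble graph $X_{\mathbf a,\mathbf b}$ has as vertices the pairs $(w,u)$ where $w=w_1\cdots w_k$ is a finite (possibly empty) word with $w_i\in\{1,\dots,b_i-1\}$, $|w|=k\ge0$, and $u\in\{0,\dots,2a_{k+1}-1\}$. For fixed $w$ with $|w|=k$, the vertices $(w,u)$ form an oriented cycle of length $2a_{k+1}$ (a bubble). For each word $w'$ with $|w'|=k-1$, $k\ge1$, the vertices $(w',a_k),(w'1,0),\dots,(w'(b_k-1),0)$, in this cyclic order, form an oriented cycle of length $b_k$ (a branching cycle). The permutation $\alpha$ rotates every bubble by one step, $(w,u)\mapsto(w,u+1\bmod 2a_{|w|+1})$; the permutation $\beta$ rotates every branching cycle by one step and fixes every vertex not on a branching cycle. The bubble group $\Gamma_{\mathbf a,\mathbf b}$ is the group of permutations of the vertex set of $X_{\mathbf a,\mathbf b}$ generated by $\alpha$ and $\beta$. *)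

theory Defs
  imports
    "HOL-Library.Extended_Real"
    "HOL-Algebra.Bij"
    "HOL-Algebra.Generated_Groups"
begin

text \<open>Amenability of a discrete group, in von Neumann's form: there is a finitely additive,
  left-invariant probability measure defined on all subsets of the group.\<close>

definition amenable :: "('g, 'm) monoid_scheme \<Rightarrow> bool" where
  "amenable G \<longleftrightarrow> group G \<and>
     (\<exists>\<mu> :: 'g set \<Rightarrow> real.
        (\<forall>A. A \<subseteq> carrier G \<longrightarrow> 0 \<le> \<mu> A) \<and>
        \<mu> (carrier G) = 1 \<and>
        (\<forall>A B. A \<subseteq> carrier G \<longrightarrow> B \<subseteq> carrier G \<longrightarrow> A \<inter> B = {} \<longrightarrow> \<mu> (A \<union> B) = \<mu> A + \<mu> B) \<and>
        (\<forall>g \<in> carrier G. \<forall>A. A \<subseteq> carrier G \<longrightarrow> \<mu> (g <#\<^bsub>G\<^esub> A) = \<mu> A))"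

text \<open>The sequences are indexed from \<open>1\<close>; the values \<open>a 0\<close> and \<open>b 0\<close> are never used.  The word
  \<open>w\<^sub>1 \<dots> w\<^sub>k\<close> is a list, so the letter \<open>w\<^sub>i\<close> is \<open>w ! (i - 1)\<close>.\<close>

type_synonym vertex = "nat list \<times> nat"

definition words :: "(nat \<Rightarrow> nat) \<Rightarrow> nat list set" where
  "words b = {w. \<forall>i \<in> {1..length w}. w ! (i - 1) \<in> {1..b i - 1}}"

definition bubble_vertices :: "(nat \<Rightarrow> nat) \<Rightarrow> (nat \<Rightarrow> nat) \<Rightarrow> vertex set" where
  "bubble_vertices a b = {(w, u). w \<in> words b \<and> u \<in> {0..2 * a (length w + 1) - 1}}"

text \<open>Elements of \<^const>\<open>BijGroup\<close> are extensional functions, hence the \<^const>\<open>restrict\<close> in both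
  permutations.\<close>

definition bubble_alpha :: "(nat \<Rightarrow> nat) \<Rightarrow> (nat \<Rightarrow> nat) \<Rightarrow> vertex \<Rightarrow> vertex" where
  "bubble_alpha a b =
     restrict (\<lambda>(w, u). (w, (u + 1) mod (2 * a (length w + 1)))) (bubble_vertices a b)"

text \<open>For \<open>w \<noteq> []\<close> the vertex \<open>(w, 0)\<close> is the one with number \<open>last w\<close> on the branching cycle of
  \<open>butlast w\<close>, which has length \<open>b (length w)\<close>; \<open>([], 0)\<close> is on no branching cycle.\<close>

definition bubble_beta :: "(nat \<Rightarrow> nat) \<Rightarrow> (nat \<Rightarrow> nat) \<Rightarrow> vertex \<Rightarrow> vertex" where
  "bubble_beta a b =
     restrict (\<lambda>(w, u).
       if u = a (length w + 1) then (w @ [1], 0)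
       else if u = 0 \<and> w \<noteq> [] then
         (if last w < b (length w) - 1 then (butlast w @ [last w + 1], 0)
          else (butlast w, a (length w)))
       else (w, u)) (bubble_vertices a b)"

definition bubble_group :: "(nat \<Rightarrow> nat) \<Rightarrow> (nat \<Rightarrow> nat) \<Rightarrow> (vertex \<Rightarrow> vertex) monoid" where
  "bubble_group a b =
     (BijGroup (bubble_vertices a b))
       \<lparr>carrier := generate (BijGroup (bubble_vertices a b)) {bubble_alpha a b, bubble_beta a b}\<rparr>"

lemma words_Nil [simp]: "[] \<in> words b"
  by (simp add: words_def)

lemma words_snoc [simp]: "w @ [i] \<in> words b \<longleftrightarrow> w \<in> words b \<and> i \<in> {1..b (length w + 1) - 1}"
  by (auto simp: words_def nth_append atLeastAtMostSuc_conv)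

text \<open>\<^const>\<open>bubble_beta\<close> rotates each branching cycle by one step and fixes the other vertices.\<close>

definition branching_cycle :: "(nat \<Rightarrow> nat) \<Rightarrow> (nat \<Rightarrow> nat) \<Rightarrow> nat list \<Rightarrow> vertex list" where
  "branching_cycle a b w =
     (w, a (length w + 1)) # map (\<lambda>i. (w @ [i], 0)) [1..<b (length w + 1)]"

lemma length_branching_cycle:
  "b (length w + 1) \<ge> 2 \<Longrightarrow> length (branching_cycle a b w) = b (length w + 1)"
  by (simp add: branching_cycle_def)

lemma bubble_beta_branching_cycle:
  assumes a: "\<forall>i\<ge>1. a i \<ge> 1" and b: "\<forall>i\<ge>1. b i \<ge> 2"
    and w: "w \<in> words b" and j: "j < b (length w + 1)"
  shows "bubble_beta a b (branching_cycle a b w ! j) =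
         branching_cycle a b w ! ((j + 1) mod b (length w + 1))"
proof -
  have a1: "a (Suc n) \<ge> 1" and b2: "b (Suc n) \<ge> 2" for n
    using a b by simp_all
  show ?thesis
  proof (cases j)
    case 0
    have "(w, a (length w + 1)) \<in> bubble_vertices a b"
      using a1[of "length w"] w by (auto simp: bubble_vertices_def)
    then show ?thesis
      using 0 b2[of "length w"] by (auto simp: branching_cycle_def bubble_beta_def)
  next
    case (Suc i)
    have "(w @ [j], 0) \<in> bubble_vertices a b"
      using w j Suc by (auto simp: bubble_vertices_def)
    moreover have "a (Suc (Suc (length w))) \<noteq> 0"
      using a1[of "Suc (length w)"] by simp
    moreover have "[1..<b (length w + 1)] ! i = j"
      using j Suc by (subst nth_upt) auto
    then have "branching_cycle a b w ! j = (w @ [j], 0)"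
      using j Suc by (simp add: branching_cycle_def)
    ultimately have "bubble_beta a b (branching_cycle a b w ! j) =
        (if j < b (length w + 1) - 1 then (w @ [j + 1], 0) else (w, a (length w + 1)))"
      by (auto simp: bubble_beta_def)
    also have "\<dots> = branching_cycle a b w ! ((j + 1) mod b (length w + 1))"
    proof (cases "j + 1 = b (length w + 1)")
      case True
      then show ?thesis by (auto simp: branching_cycle_def)
    next
      case False
      then show ?thesis using j by (auto simp: branching_cycle_def)
    qed
    finally show ?thesis .
  qed
qed

lemma bubble_beta_fixes:
  assumes v: "v \<in> bubble_vertices a b"
    and "\<forall>w \<in> words b. v \<notin> set (branching_cycle a b w)"
  shows "bubble_beta a b v = v"
proof -
  obtain w u where wu: "v = (w, u)" by (cases v)
  have w: "w \<in> words b" using v wu by (simp add: bubble_vertices_def)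
  have "u \<noteq> a (length w + 1)"
    using assms(2) w wu by (auto simp: branching_cycle_def)
  moreover have "\<not> (u = 0 \<and> w \<noteq> [])"
  proof
    assume u: "u = 0 \<and> w \<noteq> []"
    then obtain w' i where w': "w = w' @ [i]" by (metis rev_exhaust)
    then have "w' \<in> words b" "v \<in> set (branching_cycle a b w')"
      using w u wu by (auto simp: branching_cycle_def)
    then show False using assms(2) by blast
  qed
  ultimately show ?thesis using v wu by (auto simp: bubble_beta_def)
qed

lemma bubble_alpha_in_Bij:
  assumes a: "\<forall>i\<ge>1. a i \<ge> 1"
  shows "bubble_alpha a b \<in> Bij (bubble_vertices a b)"
proof -
  let ?V = "bubble_vertices a b"
  let ?f = "\<lambda>(w::nat list, u). (w, (u + 1) mod (2 * a (length w + 1)))"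
  let ?g = "\<lambda>(w::nat list, u). (w, if u = 0 then 2 * a (length w + 1) - 1 else u - 1)"
  have pos: "a (Suc n) > 0" for n
    using a by (simp add: Suc_le_eq)
  have V: "(w, u) \<in> ?V \<longleftrightarrow> w \<in> words b \<and> u < 2 * a (length w + 1)" for w u
    using pos[of "length w"] by (auto simp: bubble_vertices_def)
  have "bij_betw ?f ?V ?V"
  proof (rule bij_betw_byWitness[where f' = ?g])
    show "\<forall>x\<in>?V. ?g (?f x) = x"
      by (auto simp: V mod_Suc)
    show "\<forall>x\<in>?V. ?f (?g x) = x"
      by (auto simp: V)
    show "?f ` ?V \<subseteq> ?V"
      using pos by (auto simp: V)
    show "?g ` ?V \<subseteq> ?V"
      using pos by (auto simp: V)
  qed
  then show ?thesis
    by (auto simp: Bij_def bubble_alpha_def cong: bij_betw_cong)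
qed

lemma bubble_beta_in_Bij:
  assumes a: "\<forall>i\<ge>1. a i \<ge> 1" and b: "\<forall>i\<ge>1. b i \<ge> 2"
  shows "bubble_beta a b \<in> Bij (bubble_vertices a b)"
proof -
  let ?V = "bubble_vertices a b"
  let ?f = "\<lambda>(w::nat list, u).
       if u = a (length w + 1) then (w @ [1], 0)
       else if u = 0 \<and> w \<noteq> [] then
         (if last w < b (length w) - 1 then (butlast w @ [last w + 1], 0)
          else (butlast w, a (length w)))
       else (w, u)"
  let ?g = "\<lambda>(w::nat list, u).
       if u = a (length w + 1) then (w @ [b (length w + 1) - 1], 0)
       else if u = 0 \<and> w \<noteq> [] then
         (if last w > 1 then (butlast w @ [last w - 1], 0)
          else (butlast w, a (length w)))
       else (w, u)"
  have a1: "a (Suc n) > 0" and b2: "b (Suc n) \<ge> 2" for n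
    using a b by (simp_all add: Suc_le_eq)
  have a1': "a (Suc n) = 0 \<longleftrightarrow> False" "0 = a (Suc n) \<longleftrightarrow> False"
    "a (Suc n) \<le> 2 * a (Suc n) - Suc 0" for n
    using a1[of n] by simp_all
  have b2': "Suc 0 \<le> b (Suc n) - Suc 0" for n
    using b2[of n] by simp
  have V: "(w, u) \<in> ?V \<longleftrightarrow> w \<in> words b \<and> u \<le> 2 * a (length w + 1) - 1" for w u
    by (auto simp: bubble_vertices_def)
  have cases: "P x" if x: "x \<in> ?V"
    and 1: "\<And>w. w \<in> words b \<Longrightarrow> P (w, a (length w + 1))"
    and 2: "\<And>w i. w \<in> words b \<Longrightarrow> 1 \<le> i \<Longrightarrow> i \<le> b (length w + 1) - 1 \<Longrightarrow> P (w @ [i], 0)"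
    and 3: "\<And>w u. (w, u) \<in> ?V \<Longrightarrow> u \<noteq> a (length w + 1) \<Longrightarrow> \<not> (u = 0 \<and> w \<noteq> []) \<Longrightarrow> P (w, u)"
    for P x
  proof -
    obtain w u where wu: "x = (w, u)" by (cases x)
    show ?thesis
    proof (cases "u = 0 \<and> w \<noteq> []")
      case True
      then obtain w' i where "w = w' @ [i]" by (metis rev_exhaust)
      then show ?thesis using True x wu 2 by (auto simp: V)
    next
      case False
      then show ?thesis using x wu 1 3 by (cases "u = a (length w + 1)") (auto simp: V)
    qed
  qed
  have "bij_betw ?f ?V ?V"
  proof (rule bij_betw_byWitness[where f' = ?g])
    have "?g (?f x) = x" if "x \<in> ?V" for x
      using that by (rule cases) (auto simp: a1' b2' butlast_append)
    then show "\<forall>x\<in>?V. ?g (?f x) = x" by blast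
    have "?f (?g x) = x" if "x \<in> ?V" for x
      using that by (rule cases) (auto simp: a1' b2' butlast_append)
    then show "\<forall>x\<in>?V. ?f (?g x) = x" by blast
    have "?f x \<in> ?V" if "x \<in> ?V" for x
      using that by (rule cases) (auto simp: V a1' b2' butlast_append)
    then show "?f ` ?V \<subseteq> ?V" by blast
    have "?g x \<in> ?V" if "x \<in> ?V" for x
      using that by (rule cases) (auto simp: V a1' b2' butlast_append)
    then show "?g ` ?V \<subseteq> ?V" by blast
  qed
  then show ?thesis
    by (auto simp: Bij_def bubble_beta_def cong: bij_betw_cong)
qed

lemma group_bubble_group:
  assumes "\<forall>i\<ge>1. a i \<ge> 1" and "\<forall>i\<ge>1. b i \<ge> 2"
  shows "group (bubble_group a b)"
proof -
  interpret S: group "BijGroup (bubble_vertices a b)"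
    by (rule group_BijGroup)
  have "{bubble_alpha a b, bubble_beta a b} \<subseteq> carrier (BijGroup (bubble_vertices a b))"
    using bubble_alpha_in_Bij bubble_beta_in_Bij assms by (simp add: BijGroup_def)
  then show ?thesis
    unfolding bubble_group_def
    by (intro S.subgroup_imp_group S.generate_is_subgroup)
qed

end

theory Submission
  imports Defs "HOL-Analysis.Function_Topology"
begin

text \<open>Write \<open>\<alpha>\<close>, \<open>\<beta>\<close> for the two generators of the bubble group \<open>\<Gamma>\<close> and \<open>\<beta>\<^sub>j = \<alpha>\<^bsup>-j\<^esup> \<beta> \<alpha>\<^sup>j\<close>.  The permutation
  \<open>\<beta>\<close> moves only vertices \<open>(w, u)\<close> with \<open>u\<close> divisible by \<open>a\<^sub>k\<close>, where \<open>k = |w| + 1\<close>, so \<open>\<beta>\<^sub>j\<close> moves only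
  vertices with \<open>a\<^sub>k\<close> dividing \<open>u + j\<close>.  If \<open>i \<noteq> j\<close>, a vertex moved by both \<open>\<beta>\<^sub>i\<close> and \<open>\<beta>\<^sub>j\<close> has \<open>a\<^sub>k\<close> dividing
  \<open>i - j\<close>; since \<open>a\<^sub>k\<close> tends to infinity, this bounds the length of \<open>w\<close>, and there are only finitely
  many vertices with \<open>w\<close> of bounded length, because the alphabets are finite.  Away from this finite set the
  supports of \<open>\<beta>\<^sub>i\<close> and \<open>\<beta>\<^sub>j\<close> are disjoint, so \<open>\<beta>\<^sub>i\<close> and \<open>\<beta>\<^sub>j\<close> commute up to a finitary permutation
  (\<open>conj_beta_commute_mod_finitary\<close>).  Let \<open>N\<close> be the group of finitary elements of \<open>\<Gamma>\<close>.  It is normal and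
  locally finite, and \<open>\<Gamma> / N\<close> is generated by the images of \<open>\<alpha>\<close> and \<open>\<beta>\<close>, all of whose \<open>\<beta>\<^sub>j\<close> commute: it is
  a quotient of the wreath product \<open>\<int> wr \<int>\<close>.  Thus \<open>\<Gamma>\<close> is an extension of a locally finite group by a
  metabelian one.

  Amenability of such an extension is obtained from explicit almost invariant measures rather than
  from general closure properties of amenable groups.  A Foelner set of \<open>\<int> wr \<int>\<close> consists of the
  lamp configurations \<open>c\<close> on \<open>{0, \<dots>, n - 1}\<close> with values below \<open>n\<close>, together with a cursor \<open>p < n\<close>.  The
  products \<open>\<alpha>\<^sup>p \<beta>\<^sub>0\<^bsup>c(0)\<^esup> \<dots> \<beta>\<^bsub>n-1\<^esub>\<^bsup>c(n-1)\<^esup>\<close> form a family in \<open>\<Gamma>\<close>, perhaps with repetitions, which the generators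
  permute modulo \<open>N\<close> up to a proportion \<open>1/n\<close> (\<open>amenable_if_conjugates_commute\<close>).  The finitely many
  elements of \<open>N\<close> that measure the failure modulo \<open>N\<close> lie in a finite subgroup \<open>K\<close>, and averaging over
  \<open>K\<close> removes it (\<open>amenable_if_quotient_almost_acts\<close>).  Compactness turns almost invariant measures into
  an invariant one (\<open>amenable_if_almost_invariant\<close>).\<close>

section \<open>Invariant means as limits of almost invariant ones\<close>

lemma compact_unit_functions: "compact {m :: 'b \<Rightarrow> real. \<forall>A. 0 \<le> m A \<and> m A \<le> 1}"
proof -
  have "{m :: 'b \<Rightarrow> real. \<forall>A. 0 \<le> m A \<and> m A \<le> 1} = PiE UNIV (\<lambda>_. {0..1})"
    by (auto simp: PiE_def)
  moreover have "compactin (product_topology (\<lambda>_. euclidean) UNIV) (PiE UNIV (\<lambda>_::'b. {0..1::real}))"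
    by (simp add: compactin_PiE compactin_euclidean_iff)
  ultimately show ?thesis
    by (simp add: euclidean_product_topology compactin_euclidean_iff)
qed

definition finitely_additive_prob :: "'a set \<Rightarrow> ('a set \<Rightarrow> real) \<Rightarrow> bool" where
  "finitely_additive_prob X m \<longleftrightarrow>
     (\<forall>A. A \<subseteq> X \<longrightarrow> 0 \<le> m A) \<and> m X = 1 \<and>
     (\<forall>A B. A \<subseteq> X \<longrightarrow> B \<subseteq> X \<longrightarrow> A \<inter> B = {} \<longrightarrow> m (A \<union> B) = m A + m B)"

lemma finitely_additive_prob_le_1:
  assumes "finitely_additive_prob X m" "A \<subseteq> X"
  shows "m A \<le> 1"
proof -
  have "m (A \<union> (X - A)) = m A + m (X - A)"
    using assms unfolding finitely_additive_prob_def
    by (metis Diff_disjoint Diff_subset)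
  moreover have "A \<union> (X - A) = X" using assms by blast
  moreover have "m X = 1" "0 \<le> m (X - A)"
    using assms unfolding finitely_additive_prob_def by auto
  ultimately show ?thesis by simp
qed

lemma (in group) l_coset_inv_cancel:
  assumes "s \<in> carrier G" "A \<subseteq> carrier G"
  shows "s <# (inv s <# A) = A"
  using assms by (simp add: lcos_m_assoc lcos_mult_one)

text \<open>The finitely additive probabilities with invariance defect at most \<open>1 / (k + 1)\<close> form a decreasing
  sequence of nonempty closed subsets of a cube, which is compact by Tychonoff's theorem; a point in
  their intersection is invariant under \<open>S\<close>, hence under the group that \<open>S\<close> generates.\<close>

lemma (in group) amenable_if_almost_invariant:
  assumes S: "S \<subseteq> carrier G" and gen: "carrier G = generate G S"
    and almost: "\<And>\<epsilon>::real. 0 < \<epsilon> \<Longrightarrow> \<exists>m. finitely_additive_prob (carrier G) m \<and>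
      (\<forall>s\<in>S. \<forall>A. A \<subseteq> carrier G \<longrightarrow> \<bar>m (s <# A) - m A\<bar> \<le> \<epsilon>)"
  shows "amenable G"
proof -
  let ?U = "{m :: 'a set \<Rightarrow> real. \<forall>A. 0 \<le> m A \<and> m A \<le> 1}"
  define C where "C k = {m :: 'a set \<Rightarrow> real. m (carrier G) = 1 \<and>
     (\<forall>A B. A \<subseteq> carrier G \<longrightarrow> B \<subseteq> carrier G \<longrightarrow> A \<inter> B = {} \<longrightarrow> m (A \<union> B) = m A + m B) \<and>
     (\<forall>s. s \<in> S \<longrightarrow> (\<forall>A. A \<subseteq> carrier G \<longrightarrow> \<bar>m (s <# A) - m A\<bar> \<le> 1 / real (Suc k)))}" for k
  have closed_C: "closed (C k)" for k
    unfolding C_def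
    by (intro closed_Collect_conj closed_Collect_all closed_Collect_imp open_Collect_const
        closed_Collect_le closed_Collect_eq continuous_intros continuous_on_product_coordinates)
  have antimono_C: "C k \<subseteq> C j" if "j \<le> k" for j k
  proof -
    have "1 / real (Suc k) \<le> 1 / real (Suc j)" using that by (simp add: frac_le)
    then show ?thesis unfolding C_def by (blast intro: order_trans)
  qed
  have nonempty: "?U \<inter> C k \<noteq> {}" for k
  proof -
    obtain m where m: "finitely_additive_prob (carrier G) m"
      and inv: "\<And>s A. s \<in> S \<Longrightarrow> A \<subseteq> carrier G \<Longrightarrow> \<bar>m (s <# A) - m A\<bar> \<le> 1 / real (Suc k)"
      using almost[of "1 / real (Suc k)"] by auto
    \<comment> \<open>The measure is controlled only on subsets of the group; the value 0 elsewhere keeps it in the cube.\<close>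
    define m' where "m' A = (if A \<subseteq> carrier G then m A else 0)" for A
    have "m' \<in> ?U"
      using m finitely_additive_prob_le_1[OF m] by (auto simp: m'_def finitely_additive_prob_def)
    moreover have "s <# A \<subseteq> carrier G" if "s \<in> S" "A \<subseteq> carrier G" for s A
      using that S by (intro l_coset_subset_G) auto
    then have "m' \<in> C k"
      using m inv by (simp add: C_def m'_def finitely_additive_prob_def)
    ultimately show ?thesis by blast
  qed
  have "?U \<inter> (\<Inter>k\<in>UNIV. C k) \<noteq> {}"
  proof (rule compact_imp_fip_image[OF compact_unit_functions closed_C])
    fix I :: "nat set" assume I: "finite I"
    have "?U \<inter> C (Max (insert 0 I)) \<subseteq> ?U \<inter> (\<Inter>k\<in>I. C k)"
      using antimono_C I by (intro Int_mono order_refl INT_greatest) auto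
    then show "?U \<inter> (\<Inter>k\<in>I. C k) \<noteq> {}"
      using nonempty by blast
  qed
  then obtain m where U: "m \<in> ?U" and C: "\<And>k. m \<in> C k" by blast
  have inv_S: "m (s <# A) = m A" if "s \<in> S" "A \<subseteq> carrier G" for s A
  proof -
    have "\<bar>m (s <# A) - m A\<bar> \<le> e" if e: "0 < e" for e :: real
    proof -
      obtain k where "1 / real (Suc k) < e"
        using nat_approx_posE[OF e] by auto
      moreover have "\<bar>m (s <# A) - m A\<bar> \<le> 1 / real (Suc k)"
        using C[of k] \<open>s \<in> S\<close> \<open>A \<subseteq> carrier G\<close> unfolding C_def by blast
      ultimately show ?thesis by linarith
    qed
    then have "\<bar>m (s <# A) - m A\<bar> \<le> 0" by (rule field_le_epsilon) simp
    then show ?thesis by simp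
  qed
  have "\<forall>A. A \<subseteq> carrier G \<longrightarrow> m (g <# A) = m A" if "g \<in> generate G S" for g
    using that
  proof (induction rule: generate.induct)
    case one
    then show ?case by (simp add: lcos_mult_one)
  next
    case (incl s)
    then show ?case by (simp add: inv_S)
  next
    case (inv s)
    show ?case
    proof (intro allI impI)
      fix A assume A: "A \<subseteq> carrier G"
      have s: "s \<in> carrier G" using inv S by blast
      have "m (s <# (inv s <# A)) = m (inv s <# A)"
        using inv A s by (intro inv_S l_coset_subset_G) auto
      then show "m (inv s <# A) = m A"
        using A s by (simp add: l_coset_inv_cancel)
    qed
  next
    case (eng g h)
    have gh: "g \<in> carrier G" "h \<in> carrier G" using eng gen by auto
    show ?case
    proof (intro allI impI)
      fix A assume A: "A \<subseteq> carrier G"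
      have "m (g \<otimes> h <# A) = m (g <# (h <# A))"
        using gh A by (simp add: lcos_m_assoc)
      also have "\<dots> = m A"
        using eng gh A by (simp add: l_coset_subset_G)
      finally show "m (g \<otimes> h <# A) = m A" .
    qed
  qed
  then show ?thesis
    unfolding amenable_def using U C[of 0] gen group_axioms
    by (intro conjI exI[of _ m]) (auto simp: C_def)
qed

section \<open>Almost actions modulo a locally finite kernel\<close>

definition locally_finite_subgroup :: "'a set \<Rightarrow> ('a, 'm) monoid_scheme \<Rightarrow> bool" where
  "locally_finite_subgroup N G \<longleftrightarrow>
     (\<forall>F. finite F \<longrightarrow> F \<subseteq> N \<longrightarrow> (\<exists>K. subgroup K G \<and> finite K \<and> F \<subseteq> K \<and> K \<subseteq> N))"

lemma (in group) mem_l_coset_iff: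
  assumes "s \<in> carrier G" "A \<subseteq> carrier G" "x \<in> carrier G"
  shows "s \<otimes> x \<in> s <# A \<longleftrightarrow> x \<in> A"
  using assms by (auto simp: l_coset_def)

text \<open>The image under \<open>f\<close> of the uniform measure on a finite index set.  An element
  counts as often as it is indexed, so that a Foelner set of one group still gives an almost invariant
  measure after it is mapped to another group by a homomorphism that is not injective on it.\<close>

definition pushforward :: "'i set \<Rightarrow> ('i \<Rightarrow> 'a) \<Rightarrow> 'a set \<Rightarrow> real" where
  "pushforward I f A = real (card {i \<in> I. f i \<in> A}) / real (card I)"

lemma finitely_additive_prob_pushforward:
  assumes "finite I" "I \<noteq> {}" "f ` I \<subseteq> X"
  shows "finitely_additive_prob X (pushforward I f)"
proof -
  have "{i \<in> I. f i \<in> X} = I" using assms(3) by auto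
  moreover have "card {i \<in> I. f i \<in> A \<union> B} = card {i \<in> I. f i \<in> A} + card {i \<in> I. f i \<in> B}"
    if "A \<inter> B = {}" for A B
  proof -
    have "{i \<in> I. f i \<in> A \<union> B} = {i \<in> I. f i \<in> A} \<union> {i \<in> I. f i \<in> B}" by auto
    then show ?thesis using assms(1) that by (auto intro!: card_Un_disjoint)
  qed
  ultimately show ?thesis
    using assms by (simp add: finitely_additive_prob_def pushforward_def add_divide_distrib)
qed

text \<open>The measure is the distribution of \<open>\<phi> i \<otimes> k\<close> for uniform \<open>i \<in> I\<close> and \<open>k \<in> K\<close>, where \<open>K\<close> is a finite subgroup
  of the kernel.  Whenever \<open>s \<otimes> \<phi> i\<close> and \<open>\<phi> (\<sigma> s i)\<close> agree in the quotient, they differ on the right by an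
  element \<open>\<nu> s i\<close> of the kernel; there are finitely many of these, so \<open>K\<close> can be chosen to contain them,
  and then \<open>s\<close> carries the fibre over \<open>i\<close> exactly onto the fibre over \<open>\<sigma> s i\<close>.  Only the exceptional indices
  contribute to the defect of invariance.\<close>

lemma (in group_hom) amenable_if_quotient_almost_acts:
  assumes S: "S \<subseteq> carrier G" "finite S" and gen: "carrier G = generate G S"
    and lf: "locally_finite_subgroup (kernel G H h) G"
    and act: "\<And>\<epsilon>::real. 0 < \<epsilon> \<Longrightarrow> \<exists>(I :: 'i set) \<phi> \<sigma>. finite I \<and> I \<noteq> {} \<and> \<phi> ` I \<subseteq> carrier G \<and>
      (\<forall>s\<in>S. bij_betw (\<sigma> s) I I \<and>
         real (card {i \<in> I. h (s \<otimes> \<phi> i) \<noteq> h (\<phi> (\<sigma> s i))}) \<le> \<epsilon> * real (card I))"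
  shows "amenable G"
proof (rule G.amenable_if_almost_invariant[OF S(1) gen])
  fix \<epsilon> :: real assume "0 < \<epsilon>"
  then obtain I :: "'i set" and \<phi> \<sigma> where I: "finite I" "I \<noteq> {}" and \<phi>: "\<phi> ` I \<subseteq> carrier G"
    and \<sigma>: "\<forall>s\<in>S. bij_betw (\<sigma> s) I I \<and>
      real (card {i \<in> I. h (s \<otimes> \<phi> i) \<noteq> h (\<phi> (\<sigma> s i))}) \<le> \<epsilon> * real (card I)"
    using act[OF \<open>0 < \<epsilon>\<close>] by (elim exE conjE) (rule that)
  have bij: "bij_betw (\<sigma> s) I I"
    and few: "real (card {i \<in> I. h (s \<otimes> \<phi> i) \<noteq> h (\<phi> (\<sigma> s i))}) \<le> \<epsilon> * real (card I)"
    if "s \<in> S" for s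
    using \<sigma> that by auto
  define good where "good s = {i \<in> I. h (s \<otimes> \<phi> i) = h (\<phi> (\<sigma> s i))}" for s
  define \<nu> where "\<nu> s i = inv (\<phi> (\<sigma> s i)) \<otimes> (s \<otimes> \<phi> i)" for s i
  have \<phi>_car: "\<phi> i \<in> carrier G" if "i \<in> I" for i using \<phi> that by blast
  have \<sigma>_in: "\<sigma> s i \<in> I" if "s \<in> S" "i \<in> I" for s i
    using bij[OF that(1)] that(2) by (auto simp: bij_betw_def)
  have \<nu>_ker: "\<nu> s i \<in> kernel G H h" if s: "s \<in> S" and i: "i \<in> good s" for s i
  proof -
    have "i \<in> I" and eq: "h (s \<otimes> \<phi> i) = h (\<phi> (\<sigma> s i))" using i by (auto simp: good_def)
    then have c: "\<phi> i \<in> carrier G" "\<phi> (\<sigma> s i) \<in> carrier G" "s \<in> carrier G"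
      using S s \<phi>_car \<sigma>_in by auto
    then have "h (\<nu> s i) = inv\<^bsub>H\<^esub> h (\<phi> (\<sigma> s i)) \<otimes>\<^bsub>H\<^esub> h (s \<otimes> \<phi> i)"
      by (simp add: \<nu>_def)
    then show ?thesis using c eq by (simp add: kernel_def \<nu>_def del: hom_mult)
  qed
  have fin: "finite (\<Union>s\<in>S. \<nu> s ` good s)" using S(2) I(1) by (auto simp: good_def)
  have sub: "(\<Union>s\<in>S. \<nu> s ` good s) \<subseteq> kernel G H h" using \<nu>_ker by blast
  obtain K where K: "subgroup K G" "finite K" and cover: "(\<Union>s\<in>S. \<nu> s ` good s) \<subseteq> K"
    using lf[unfolded locally_finite_subgroup_def, rule_format, OF fin sub] by (elim exE conjE)
  have \<nu>_K: "\<nu> s i \<in> K" if "s \<in> S" "i \<in> good s" for s i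
    by (rule subsetD[OF cover]) (use that in auto)
  have K_car: "K \<subseteq> carrier G" and K_ne: "K \<noteq> {}"
    using subgroup.subset[OF K(1)] subgroup.one_closed[OF K(1)] by auto
  have card_K: "card K > 0" using K K_ne by (simp add: card_gt_0_iff)
  \<comment> \<open>\<open>c i A\<close> is the part of \<open>A\<close> seen by the fibre over \<open>i\<close>; the measure is the average of these.\<close>
  define c where "c i A = card {k \<in> K. \<phi> i \<otimes> k \<in> A}" for i A
  let ?m = "pushforward (I \<times> K) (\<lambda>(i, k). \<phi> i \<otimes> k)"
  have m_eq: "?m A = (\<Sum>i\<in>I. real (c i A)) / (real (card I) * real (card K))" for A
  proof -
    have "{p \<in> I \<times> K. (case p of (i, k) \<Rightarrow> \<phi> i \<otimes> k) \<in> A} = Sigma I (\<lambda>i. {k \<in> K. \<phi> i \<otimes> k \<in> A})"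
      by auto
    then show ?thesis
      using I K by (simp add: pushforward_def card_cartesian_product c_def)
  qed
  have c_le: "c i A \<le> card K" for i A
    using K by (auto simp: c_def intro: card_mono)
  have c_diff: "\<bar>real (c i A) - real (c j B)\<bar> \<le> real (card K)" for i j A B
    using c_le[of i A] c_le[of j B] by linarith
  have c_shift: "c (\<sigma> s i) (s <# A) = c i A"
    if s: "s \<in> S" and i: "i \<in> good s" and A: "A \<subseteq> carrier G" for s i A
  proof -
    have iI: "i \<in> I" using i by (simp add: good_def)
    have car: "\<phi> i \<in> carrier G" "\<phi> (\<sigma> s i) \<in> carrier G" "s \<in> carrier G"
      using S s \<phi>_car \<sigma>_in iI by auto
    have n: "\<nu> s i \<in> K" using \<nu>_K s i .
    then have n_car: "\<nu> s i \<in> carrier G" using K_car by blast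
    have shift: "\<phi> (\<sigma> s i) \<otimes> (\<nu> s i \<otimes> k) = s \<otimes> (\<phi> i \<otimes> k)" if "k \<in> K" for k
      using subsetD[OF K_car that] car unfolding \<nu>_def by (simp add: G.m_assoc[symmetric])
    have cancel: "inv (\<nu> s i) \<otimes> (\<nu> s i \<otimes> k) = k" "\<nu> s i \<otimes> (inv (\<nu> s i) \<otimes> k) = k"
      if "k \<in> K" for k
      using n_car subsetD[OF K_car that] by (simp_all add: G.m_assoc[symmetric])
    have "bij_betw (\<lambda>k. \<nu> s i \<otimes> k) {k \<in> K. \<phi> i \<otimes> k \<in> A} {k \<in> K. \<phi> (\<sigma> s i) \<otimes> k \<in> s <# A}"
    proof (rule bij_betw_byWitness[where f' = "\<lambda>k. inv (\<nu> s i) \<otimes> k"])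
      show "(\<lambda>k. \<nu> s i \<otimes> k) ` {k \<in> K. \<phi> i \<otimes> k \<in> A} \<subseteq> {k \<in> K. \<phi> (\<sigma> s i) \<otimes> k \<in> s <# A}"
      proof clarify
        fix k assume k: "k \<in> K" and kA: "\<phi> i \<otimes> k \<in> A"
        have "s \<otimes> (\<phi> i \<otimes> k) \<in> s <# A"
          using G.mem_l_coset_iff[OF car(3) A, of "\<phi> i \<otimes> k"] kA A by blast
        then show "\<nu> s i \<otimes> k \<in> K \<and> \<phi> (\<sigma> s i) \<otimes> (\<nu> s i \<otimes> k) \<in> s <# A"
          using shift[OF k] subgroup.m_closed[OF K(1) n k] by simp
      qed
      show "(\<lambda>k. inv (\<nu> s i) \<otimes> k) ` {k \<in> K. \<phi> (\<sigma> s i) \<otimes> k \<in> s <# A} \<subseteq> {k \<in> K. \<phi> i \<otimes> k \<in> A}"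
      proof clarify
        fix k assume k: "k \<in> K" and kA: "\<phi> (\<sigma> s i) \<otimes> k \<in> s <# A"
        have inK: "inv (\<nu> s i) \<otimes> k \<in> K"
          by (rule subgroup.m_closed[OF K(1) subgroup.m_inv_closed[OF K(1) n] k])
        have "s \<otimes> (\<phi> i \<otimes> (inv (\<nu> s i) \<otimes> k)) \<in> s <# A"
          using shift[OF inK] kA cancel(2)[OF k] by simp
        moreover have "\<phi> i \<otimes> (inv (\<nu> s i) \<otimes> k) \<in> carrier G"
          using car(1) subsetD[OF K_car inK] by (rule G.m_closed)
        ultimately show "inv (\<nu> s i) \<otimes> k \<in> K \<and> \<phi> i \<otimes> (inv (\<nu> s i) \<otimes> k) \<in> A"
          using inK G.mem_l_coset_iff[OF car(3) A] by blast
      qed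
    qed (use cancel in auto)
    then show ?thesis unfolding c_def by (rule bij_betw_same_card[symmetric])
  qed
  have "\<bar>?m (s <# A) - ?m A\<bar> \<le> \<epsilon>" if s: "s \<in> S" and A: "A \<subseteq> carrier G" for s A
  proof -
    have "(\<Sum>i\<in>I. real (c i (s <# A))) = (\<Sum>i\<in>I. real (c (\<sigma> s i) (s <# A)))"
      by (rule sum.reindex_bij_betw[OF bij[OF s], symmetric])
    then have "\<bar>(\<Sum>i\<in>I. real (c i (s <# A))) - (\<Sum>i\<in>I. real (c i A))\<bar>
        = \<bar>\<Sum>i\<in>I. real (c (\<sigma> s i) (s <# A)) - real (c i A)\<bar>"
      by (simp add: sum_subtractf)
    also have "\<dots> \<le> (\<Sum>i\<in>I. \<bar>real (c (\<sigma> s i) (s <# A)) - real (c i A)\<bar>)"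
      by (rule sum_abs)
    also have "\<dots> \<le> (\<Sum>i\<in>I. if i \<in> good s then 0 else real (card K))"
      using c_shift[OF s _ A] c_diff by (intro sum_mono) auto
    also have "\<dots> = real (card (I - good s)) * real (card K)"
      using I by (simp add: sum.If_cases Diff_eq)
    also have "I - good s = {i \<in> I. h (s \<otimes> \<phi> i) \<noteq> h (\<phi> (\<sigma> s i))}"
      by (auto simp: good_def)
    also have "real (card \<dots>) * real (card K) \<le> \<epsilon> * real (card I) * real (card K)"
      using few[OF s] by (intro mult_right_mono) auto
    finally show ?thesis
      using card_K I by (simp add: m_eq diff_divide_distrib[symmetric] abs_divide card_gt_0_iff
          pos_divide_le_eq mult.assoc)
  qed
  moreover have "finitely_additive_prob (carrier G) ?m"
    using I K K_ne K_car \<phi>_car by (intro finitely_additive_prob_pushforward) auto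
  ultimately show "\<exists>m. finitely_additive_prob (carrier G) m \<and>
      (\<forall>s\<in>S. \<forall>A. A \<subseteq> carrier G \<longrightarrow> \<bar>m (s <# A) - m A\<bar> \<le> \<epsilon>)"
    by blast
qed

section \<open>Groups generated by two elements with commuting conjugates\<close>

primrec ordered_prod :: "('a, 'm) monoid_scheme \<Rightarrow> (nat \<Rightarrow> 'a) \<Rightarrow> nat \<Rightarrow> 'a" where
  "ordered_prod G f 0 = \<one>\<^bsub>G\<^esub>"
| "ordered_prod G f (Suc n) = ordered_prod G f n \<otimes>\<^bsub>G\<^esub> f n"

lemma (in monoid) ordered_prod_closed:
  "(\<And>i. i < n \<Longrightarrow> f i \<in> carrier G) \<Longrightarrow> ordered_prod G f n \<in> carrier G"
  by (induction n) auto

lemma ordered_prod_cong: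
  "(\<And>i. i < n \<Longrightarrow> f i = g i) \<Longrightarrow> ordered_prod G f n = ordered_prod G g n"
  by (induction n) auto

lemma (in monoid) ordered_prod_commute:
  assumes "z \<in> carrier G" "\<And>i. i < n \<Longrightarrow> f i \<in> carrier G" "\<And>i. i < n \<Longrightarrow> z \<otimes> f i = f i \<otimes> z"
  shows "z \<otimes> ordered_prod G f n = ordered_prod G f n \<otimes> z"
  using assms
proof (induction n)
  case (Suc n)
  have P: "ordered_prod G f n \<in> carrier G" using Suc by (intro ordered_prod_closed) auto
  have "z \<otimes> ordered_prod G f (Suc n) = (z \<otimes> ordered_prod G f n) \<otimes> f n"
    using Suc.prems(1,2) P by (simp add: m_assoc)
  also have "\<dots> = (ordered_prod G f n \<otimes> z) \<otimes> f n"
    using Suc by simp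
  also have "\<dots> = ordered_prod G f n \<otimes> (f n \<otimes> z)"
    using Suc.prems(1,2) Suc.prems(3)[of n] P by (simp add: m_assoc)
  finally show ?case using Suc.prems(1,2) P by (simp add: m_assoc)
qed simp

text \<open>Multiplication by the lamp generator at position \<open>p\<close> switches the lamp at \<open>p\<close> one step further.\<close>

lemma (in group) ordered_prod_increment:
  fixes c :: "nat \<Rightarrow> nat"
  assumes z: "\<And>i. z i \<in> carrier G" and comm: "\<And>i j. z i \<otimes> z j = z j \<otimes> z i"
    and p: "p < n"
  shows "z p \<otimes> ordered_prod G (\<lambda>i. z i [^] c i) n
       = ordered_prod G (\<lambda>i. z i [^] (c(p := Suc (c p))) i) n"
  using p
proof (induction n)
  case (Suc n)
  let ?P = "ordered_prod G (\<lambda>i. z i [^] c i) n"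
  let ?P' = "ordered_prod G (\<lambda>i. z i [^] (c(p := Suc (c p))) i) n"
  have P: "?P \<in> carrier G" using z by (intro ordered_prod_closed) auto
  show ?case
  proof (cases "p = n")
    case True
    have "?P' = ?P" using True by (intro ordered_prod_cong) auto
    moreover have "z p \<otimes> ?P = ?P \<otimes> z p"
      using z comm by (intro ordered_prod_commute) (auto intro!: group_commutes_pow[symmetric])
    then have "z p \<otimes> (?P \<otimes> z p [^] c p) = ?P \<otimes> (z p \<otimes> z p [^] c p)"
      using z P by (simp add: m_assoc[symmetric])
    then have "z p \<otimes> (?P \<otimes> z p [^] c p) = ?P \<otimes> z p [^] Suc (c p)"
      using z[of p] by (simp only: nat_pow_Suc2)
    ultimately show ?thesis using True by simp
  next
    case False
    then have "z p \<otimes> ?P = ?P'" using Suc by simp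
    then show ?thesis using False z P by (simp add: m_assoc[symmetric])
  qed
qed simp

lemma (in group_hom) hom_ordered_prod:
  "(\<And>i. i < n \<Longrightarrow> f i \<in> carrier G) \<Longrightarrow>
    h (ordered_prod G f n) = ordered_prod H (\<lambda>i. h (f i)) n"
  by (induction n) (auto simp: G.ordered_prod_closed)

lemma card_PiE_fixed_value:
  fixes n :: nat
  assumes "p < n" "v < n"
  shows "card {c \<in> {..<n} \<rightarrow>\<^sub>E {..<n}. c p = v} = n ^ (n - 1)"
proof -
  have "{c \<in> {..<n} \<rightarrow>\<^sub>E {..<n}. c p = v} = PiE {..<n} (\<lambda>q. if q = p then {v} else {..<n})"
    (is "?L = ?R")
  proof (intro subset_antisym subsetI)
    fix c assume "c \<in> ?L"
    then show "c \<in> ?R" by (intro PiE_I) auto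
  next
    fix c assume c: "c \<in> ?R"
    have "c p = v" using PiE_mem[OF c, of p] assms(1) by simp
    moreover have "c q < n" if "q < n" for q
      using PiE_mem[OF c, of q] that assms(2) by (cases "q = p") auto
    moreover have "c q = undefined" if "\<not> q < n" for q
      using PiE_arb[OF c, of q] that by simp
    ultimately show "c \<in> ?L" by (simp add: PiE_iff extensional_def)
  qed
  also have "card \<dots> = (\<Prod>q<n. if q = p then 1 else n)"
    by (subst card_PiE) (auto intro!: prod.cong)
  also have "\<dots> = n ^ (n - 1)"
    using assms by (subst prod.remove[of _ p]) (auto simp: prod.If_cases)
  finally show ?thesis .
qed

lemma inj_on_Suc_mod: "inj_on (\<lambda>p. Suc p mod n) {..<n}"
  by (auto simp: inj_on_def mod_Suc split: if_splits)

text \<open>If the \<open>z j\<close> commute, the image of \<open>h\<close> is a quotient of the lamplighter group \<open>\<int> wr \<int>\<close>: an index \<open>(p, c)\<close> is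
  a cursor position and a lamp configuration, represented by \<open>x\<^sup>p\<close> times the product of the powers
  \<open>(z j)\<^bsup>c j\<^esup>\<close>.  With this order of the factors, left multiplication by \<open>x\<close> moves the cursor, and since
  \<open>y x\<^sup>p = x\<^sup>p (z p)\<close>, left multiplication by \<open>y\<close> changes the lamp under the cursor.  Cyclic
  counting modulo \<open>n\<close> makes both moves permutations of the index set; they differ from the group
  multiplication only where a counter overflows, a proportion \<open>1/n\<close> of the indices.\<close>

lemma (in group_hom) amenable_if_conjugates_commute:
  assumes x: "x \<in> carrier G" and y: "y \<in> carrier G" and gen: "carrier G = generate G {x, y}"
    and lf: "locally_finite_subgroup (kernel G H h) G"
    and z: "\<And>j::nat. z j = inv (x [^] j) \<otimes> y \<otimes> x [^] j"
    and comm: "\<And>i j. h (z i \<otimes> z j) = h (z j \<otimes> z i)"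
  shows "amenable G"
proof (rule amenable_if_quotient_almost_acts[where ?'i = "nat \<times> (nat \<Rightarrow> nat)", OF _ _ gen lf])
  show "{x, y} \<subseteq> carrier G" "finite {x, y}" using x y by auto
next
  fix \<epsilon> :: real assume "0 < \<epsilon>"
  then obtain n0 :: nat where n0: "1 / real (Suc n0) < \<epsilon>" using nat_approx_posE by blast
  define n where "n = Suc n0"
  have n: "n > 0" by (simp add: n_def)
  have eps_n: "1 \<le> \<epsilon> * real n" using n0 by (simp add: n_def field_simps)
  have z_car: "z j \<in> carrier G" for j using x y by (simp add: z)
  define C where "C = {..<n} \<rightarrow>\<^sub>E {..<n}"
  define I where "I = {..<n} \<times> C"
  define P where "P c = ordered_prod G (\<lambda>j. z j [^] c j) n" for c :: "nat \<Rightarrow> nat"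
  define \<phi> where "\<phi> = (\<lambda>(p::nat, c). x [^] p \<otimes> P c)"
  define \<sigma>x where "\<sigma>x = (\<lambda>(p, c :: nat \<Rightarrow> nat). (Suc p mod n, c))"
  define \<sigma>y where "\<sigma>y = (\<lambda>(p :: nat, c). (p, c(p := Suc (c p) mod n)))"
  have P_car: "P c \<in> carrier G" for c
    using z_car by (simp add: P_def G.ordered_prod_closed)
  have finC: "finite C" by (simp add: C_def finite_PiE)
  have cardC: "card C = n ^ n" by (simp add: C_def card_PiE)
  have C_less: "c q < n" if "c \<in> C" "q < n" for c q
    using that by (auto simp: C_def)
  have C_upd: "c(p := v) \<in> C" if "c \<in> C" "p < n" "v < n" for c p v
    using that by (auto simp: C_def PiE_iff extensional_def)
  have I: "finite I" "card I = n * n ^ n"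
    using finC by (simp_all add: I_def cardC card_cartesian_product)
  have "I \<noteq> {}" using I n by auto
  have bij_x: "bij_betw \<sigma>x I I"
  proof -
    have inj: "inj_on \<sigma>x I"
    proof (rule inj_onI, clarify)
      fix p c q d assume "(p, c) \<in> I" "(q, d) \<in> I" "\<sigma>x (p, c) = \<sigma>x (q, d)"
      then show "p = q \<and> c = d"
        using inj_onD[OF inj_on_Suc_mod[of n], of p q] by (simp add: I_def \<sigma>x_def)
    qed
    have "\<sigma>x ` I \<subseteq> I" using n by (auto simp: \<sigma>x_def I_def)
    then show ?thesis
      using endo_inj_surj[OF I(1) _ inj] inj by (simp add: bij_betw_def)
  qed
  have bij_y: "bij_betw \<sigma>y I I"
  proof -
    have inj: "inj_on \<sigma>y I"
    proof (rule inj_onI, clarify)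
      fix p c q d assume c: "(p, c) \<in> I" and d: "(q, d) \<in> I" and eq: "\<sigma>y (p, c) = \<sigma>y (q, d)"
      have pq: "p = q" and upd: "c(p := Suc (c p) mod n) = d(p := Suc (d p) mod n)"
        using eq by (auto simp: \<sigma>y_def)
      have "Suc (c p) mod n = Suc (d p) mod n" using fun_cong[OF upd, of p] by simp
      then have cp: "c p = d p"
        using inj_onD[OF inj_on_Suc_mod[of n], of "c p" "d p"] C_less[of c p] C_less[of d p] c d pq
        by (simp add: I_def)
      have "c r = d r" for r
        using fun_cong[OF upd, of r] cp by (cases "r = p") auto
      then show "p = q \<and> c = d" using pq by auto
    qed
    have "\<sigma>y ` I \<subseteq> I" using C_upd n by (auto simp: \<sigma>y_def I_def)
    then show ?thesis
      using endo_inj_surj[OF I(1) _ inj] inj by (simp add: bij_betw_def)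
  qed
  have good_x: "h (x \<otimes> \<phi> (p, c)) = h (\<phi> (\<sigma>x (p, c)))" if "Suc p < n" for p c
  proof -
    have "x \<otimes> \<phi> (p, c) = (x \<otimes> x [^] p) \<otimes> P c"
      using x P_car by (simp add: \<phi>_def G.m_assoc)
    also have "\<dots> = x [^] Suc p \<otimes> P c"
      using x by (simp only: G.nat_pow_Suc2)
    finally show ?thesis using that by (simp add: \<phi>_def \<sigma>x_def)
  qed
  have good_y: "h (y \<otimes> \<phi> (p, c)) = h (\<phi> (\<sigma>y (p, c)))" if "p < n" "Suc (c p) < n" for p c
  proof -
    have "y \<otimes> \<phi> (p, c) = x [^] p \<otimes> (z p \<otimes> P c)"
      using x y P_car by (simp add: \<phi>_def z G.m_assoc[symmetric])
    then have "h (y \<otimes> \<phi> (p, c)) = h (x [^] p) \<otimes>\<^bsub>H\<^esub> (h (z p) \<otimes>\<^bsub>H\<^esub> h (P c))"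
      using x z_car P_car by simp
    also have "h (z p) \<otimes>\<^bsub>H\<^esub> h (P c) = h (P (c(p := Suc (c p))))"
      using H.ordered_prod_increment[of "\<lambda>j. h (z j)" p n c] z_car comm that(1)
      by (simp add: P_def hom_ordered_prod hom_nat_pow del: fun_upd_apply)
    finally show ?thesis using x P_car that by (simp add: \<phi>_def \<sigma>y_def)
  qed
  \<comment> \<open>Indices where the cursor overflows, then those where the lamp under it does: \<open>n ^ n\<close> of \<open>n * n ^ n\<close>.\<close>
  have few_x: "card {i \<in> I. h (x \<otimes> \<phi> i) \<noteq> h (\<phi> (\<sigma>x i))} \<le> n ^ n"
  proof -
    have "{i \<in> I. h (x \<otimes> \<phi> i) \<noteq> h (\<phi> (\<sigma>x i))} \<subseteq> {n - 1} \<times> C"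
    proof (rule subrelI)
      fix p c assume "(p, c) \<in> {i \<in> I. h (x \<otimes> \<phi> i) \<noteq> h (\<phi> (\<sigma>x i))}"
      then have "p < n" "c \<in> C" "\<not> Suc p < n" using good_x by (auto simp: I_def)
      then show "(p, c) \<in> {n - 1} \<times> C" by auto
    qed
    then have "card {i \<in> I. h (x \<otimes> \<phi> i) \<noteq> h (\<phi> (\<sigma>x i))} \<le> card ({n - 1} \<times> C)"
      using finC by (intro card_mono) auto
    then show ?thesis by (simp add: card_cartesian_product cardC)
  qed
  have few_y: "card {i \<in> I. h (y \<otimes> \<phi> i) \<noteq> h (\<phi> (\<sigma>y i))} \<le> n ^ n"
  proof -
    have "{i \<in> I. h (y \<otimes> \<phi> i) \<noteq> h (\<phi> (\<sigma>y i))} \<subseteq> Sigma {..<n} (\<lambda>p. {c \<in> C. c p = n - 1})"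
    proof (rule subrelI)
      fix p c assume "(p, c) \<in> {i \<in> I. h (y \<otimes> \<phi> i) \<noteq> h (\<phi> (\<sigma>y i))}"
      then have "p < n" "c \<in> C" "\<not> Suc (c p) < n" using good_y by (auto simp: I_def)
      then show "(p, c) \<in> Sigma {..<n} (\<lambda>p. {c \<in> C. c p = n - 1})" using C_less[of c p] by auto
    qed
    then have "card {i \<in> I. h (y \<otimes> \<phi> i) \<noteq> h (\<phi> (\<sigma>y i))}
        \<le> card (Sigma {..<n} (\<lambda>p. {c \<in> C. c p = n - 1}))"
      using finC by (intro card_mono) auto
    also have "\<dots> = n * n ^ (n - 1)"
      using finC n by (simp add: C_def card_PiE_fixed_value)
    also have "\<dots> = n ^ n" using n by (cases n) auto
    finally show ?thesis .
  qed
  have "real (n ^ n) \<le> \<epsilon> * real (card I)"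
    using mult_right_mono[OF eps_n, of "real (n ^ n)"] I by (simp add: mult.assoc)
  then have few: "real k \<le> \<epsilon> * real (card I)" if "k \<le> n ^ n" for k
    using that by (meson of_nat_mono order_trans)
  show "\<exists>(I :: (nat \<times> (nat \<Rightarrow> nat)) set) \<phi> \<sigma>. finite I \<and> I \<noteq> {} \<and> \<phi> ` I \<subseteq> carrier G \<and>
      (\<forall>s\<in>{x, y}. bij_betw (\<sigma> s) I I \<and>
         real (card {i \<in> I. h (s \<otimes> \<phi> i) \<noteq> h (\<phi> (\<sigma> s i))}) \<le> \<epsilon> * real (card I))"
  proof (intro exI conjI ballI)
    show "finite I" "I \<noteq> {}" by fact+
    show "\<phi> ` I \<subseteq> carrier G" using x P_car by (auto simp: \<phi>_def)
    fix s assume "s \<in> {x, y}"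
    then show "bij_betw ((\<lambda>s. if s = x then \<sigma>x else \<sigma>y) s) I I"
      and "real (card {i \<in> I. h (s \<otimes> \<phi> i) \<noteq> h (\<phi> ((\<lambda>s. if s = x then \<sigma>x else \<sigma>y) s i))})
          \<le> \<epsilon> * real (card I)"
      using bij_x bij_y few[OF few_x] few[OF few_y] by auto
  qed
qed

section \<open>Finitary permutations\<close>

lemma Bij_apply:
  assumes "f \<in> Bij V" "v \<in> V"
  shows "f v \<in> V"
  using assms Bij_imp_funcset by blast

lemma mult_BijGroup_apply:
  assumes "g \<in> Bij V" "f \<in> Bij V" "v \<in> V"
  shows "(g \<otimes>\<^bsub>BijGroup V\<^esub> f) v = g (f v)"
  using assms by (simp add: BijGroup_def compose_def)

lemma carrier_BijGroup [simp]: "carrier (BijGroup V) = Bij V"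
  by (simp add: BijGroup_def)

lemma Bij_eq_iff:
  assumes "f \<in> Bij V" "v \<in> V" "w \<in> V"
  shows "f v = f w \<longleftrightarrow> v = w"
  using assms by (auto simp: Bij_def bij_betw_def inj_on_def)

lemma inv_BijGroup_apply:
  assumes "f \<in> Bij V" "v \<in> V"
  shows "(inv\<^bsub>BijGroup V\<^esub> f) (f v) = v" and "f ((inv\<^bsub>BijGroup V\<^esub> f) v) = v"
    and "(inv\<^bsub>BijGroup V\<^esub> f) v \<in> V"
proof -
  interpret B: group "BijGroup V" by (rule group_BijGroup)
  have inv: "inv\<^bsub>BijGroup V\<^esub> f \<in> Bij V" using B.inv_closed[of f] assms by simp
  have one: "\<one>\<^bsub>BijGroup V\<^esub> v = v" using assms by (simp add: BijGroup_def)
  show "(inv\<^bsub>BijGroup V\<^esub> f) (f v) = v"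
    using B.l_inv[of f] one assms inv by (simp flip: mult_BijGroup_apply)
  show "f ((inv\<^bsub>BijGroup V\<^esub> f) v) = v"
    using B.r_inv[of f] one assms inv by (simp flip: mult_BijGroup_apply)
  show "(inv\<^bsub>BijGroup V\<^esub> f) v \<in> V" using inv assms(2) by (rule Bij_apply)
qed

definition moved :: "'v set \<Rightarrow> ('v \<Rightarrow> 'v) \<Rightarrow> 'v set" where
  "moved V g = {v \<in> V. g v \<noteq> v}"

lemma moved_stable:
  assumes "g \<in> Bij V" "v \<in> moved V g"
  shows "g v \<in> moved V g"
  using assms by (auto simp: moved_def Bij_apply Bij_eq_iff)

text \<open>Used twice: with finiteness, for the group of all finitary permutations, and with containment in a
  fixed set, for the subgroups that witness its local finiteness.\<close>

lemma subgroup_moved_ideal: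
  assumes "Q {}" and Un: "\<And>A B. Q A \<Longrightarrow> Q B \<Longrightarrow> Q (A \<union> B)"
    and mono: "\<And>A B. Q B \<Longrightarrow> A \<subseteq> B \<Longrightarrow> Q A"
  shows "subgroup {g \<in> Bij V. Q (moved V g)} (BijGroup V)"
proof -
  interpret B: group "BijGroup V" by (rule group_BijGroup)
  show ?thesis
  proof
    show "{g \<in> Bij V. Q (moved V g)} \<subseteq> carrier (BijGroup V)" by auto
    show "\<one>\<^bsub>BijGroup V\<^esub> \<in> {g \<in> Bij V. Q (moved V g)}"
      using B.one_closed assms(1) by (auto simp: BijGroup_def moved_def cong: conj_cong)
  next
    fix g f assume g: "g \<in> {g \<in> Bij V. Q (moved V g)}" and f: "f \<in> {g \<in> Bij V. Q (moved V g)}"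
    have "moved V (g \<otimes>\<^bsub>BijGroup V\<^esub> f) \<subseteq> moved V g \<union> moved V f"
      using g f by (auto simp: moved_def mult_BijGroup_apply)
    then have "Q (moved V (g \<otimes>\<^bsub>BijGroup V\<^esub> f))" using g f by (blast intro: mono Un)
    then show "g \<otimes>\<^bsub>BijGroup V\<^esub> f \<in> {g \<in> Bij V. Q (moved V g)}"
      using B.m_closed[of g f] g f by simp
  next
    fix g assume g: "g \<in> {g \<in> Bij V. Q (moved V g)}"
    have "moved V (inv\<^bsub>BijGroup V\<^esub> g) \<subseteq> moved V g"
      using g inv_BijGroup_apply[of g V] by (auto simp: moved_def) metis
    then have "Q (moved V (inv\<^bsub>BijGroup V\<^esub> g))" using g by (blast intro: mono)
    then show "inv\<^bsub>BijGroup V\<^esub> g \<in> {g \<in> Bij V. Q (moved V g)}"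
      using B.inv_closed[of g] g by simp
  qed
qed

definition finitary :: "'v set \<Rightarrow> ('v \<Rightarrow> 'v) set" where
  "finitary V = {g \<in> Bij V. finite (moved V g)}"

lemma finitary_normal: "finitary V \<lhd> BijGroup V"
proof -
  interpret B: group "BijGroup V" by (rule group_BijGroup)
  have "f \<otimes>\<^bsub>BijGroup V\<^esub> g \<otimes>\<^bsub>BijGroup V\<^esub> inv\<^bsub>BijGroup V\<^esub> f \<in> finitary V"
    if f: "f \<in> Bij V" and g: "g \<in> finitary V" for f g
  proof -
    let ?c = "f \<otimes>\<^bsub>BijGroup V\<^esub> g \<otimes>\<^bsub>BijGroup V\<^esub> inv\<^bsub>BijGroup V\<^esub> f"
    have gB: "g \<in> Bij V" "finite (moved V g)" using g by (auto simp: finitary_def)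
    have fi: "inv\<^bsub>BijGroup V\<^esub> f \<in> Bij V" and fg: "f \<otimes>\<^bsub>BijGroup V\<^esub> g \<in> Bij V"
      using B.inv_closed[of f] B.m_closed[of f g] f gB by simp_all
    have c: "?c \<in> Bij V" using B.m_closed[OF _ _] fi fg by simp
    have "moved V ?c \<subseteq> f ` moved V g"
    proof
      fix v assume v: "v \<in> moved V ?c"
      then have "v \<in> V" by (simp add: moved_def)
      let ?w = "(inv\<^bsub>BijGroup V\<^esub> f) v"
      have w: "?w \<in> V" "f ?w = v" using inv_BijGroup_apply[OF f \<open>v \<in> V\<close>] by auto
      have "?c v = f (g ?w)"
        using f gB fi fg w \<open>v \<in> V\<close> by (simp add: mult_BijGroup_apply)
      then have "g ?w \<noteq> ?w" using v w by (auto simp: moved_def)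
      then show "v \<in> f ` moved V g" using w by (auto simp: moved_def intro!: image_eqI[of v f ?w])
    qed
    then have "finite (moved V ?c)" using gB finite_subset by blast
    then show ?thesis using c by (simp add: finitary_def)
  qed
  moreover have "subgroup (finitary V) (BijGroup V)"
    unfolding finitary_def by (rule subgroup_moved_ideal) (auto intro: finite_subset)
  ultimately show ?thesis by (simp add: B.normal_inv_iff)
qed

text \<open>Such a permutation stabilises \<open>T\<close>, and it is determined by its restriction to \<open>T\<close>.\<close>

lemma finite_Bij_moved_subset:
  assumes "finite T" "T \<subseteq> V"
  shows "finite {g \<in> Bij V. moved V g \<subseteq> T}"
proof (rule inj_on_finite)
  let ?K = "{g \<in> Bij V. moved V g \<subseteq> T}"
  show "inj_on (\<lambda>g. restrict g T) ?K"
  proof (rule inj_onI)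
    fix f g assume f: "f \<in> ?K" and g: "g \<in> ?K" and eq: "restrict f T = restrict g T"
    show "f = g"
    proof (rule extensionalityI)
      show "f \<in> extensional V" "g \<in> extensional V" using f g by (auto simp: Bij_def)
      fix v assume v: "v \<in> V"
      show "f v = g v"
      proof (cases "v \<in> T")
        case True
        then show ?thesis using fun_cong[OF eq, of v] by simp
      next
        case False
        then have "f v = v" "g v = v" using f g v by (auto simp: moved_def)
        then show ?thesis by simp
      qed
    qed
  qed
  show "(\<lambda>g. restrict g T) ` ?K \<subseteq> T \<rightarrow>\<^sub>E T"
  proof clarify
    fix g assume g: "g \<in> Bij V" "moved V g \<subseteq> T"
    have "g v \<in> T" if v: "v \<in> T" for v
    proof (cases "g v = v")
      case False
      then have "v \<in> moved V g" using assms v by (auto simp: moved_def)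
      then show ?thesis using subsetD[OF g(2) moved_stable[OF g(1)]] by simp
    qed (use v in simp)
    then show "restrict g T \<in> T \<rightarrow>\<^sub>E T" by auto
  qed
  show "finite (T \<rightarrow>\<^sub>E T)" using assms by (simp add: finite_PiE)
qed

lemma locally_finite_finitary: "locally_finite_subgroup (finitary V) (BijGroup V)"
  unfolding locally_finite_subgroup_def
proof (intro allI impI)
  fix F assume F: "finite F" "F \<subseteq> finitary V"
  define T where "T = (\<Union>g\<in>F. moved V g)"
  have T: "finite T" "T \<subseteq> V" using F by (auto simp: T_def finitary_def moved_def)
  have "subgroup {g \<in> Bij V. moved V g \<subseteq> T} (BijGroup V)"
    by (rule subgroup_moved_ideal) auto
  moreover have "{g \<in> Bij V. moved V g \<subseteq> T} \<subseteq> finitary V"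
    using T finite_subset by (auto simp: finitary_def)
  moreover have "F \<subseteq> {g \<in> Bij V. moved V g \<subseteq> T}"
    using F by (auto simp: T_def finitary_def)
  ultimately show "\<exists>K. subgroup K (BijGroup V) \<and> finite K \<and> F \<subseteq> K \<and> K \<subseteq> finitary V"
    using finite_Bij_moved_subset[OF T] by blast
qed

lemma (in group) locally_finite_subgroup_Int:
  assumes N: "locally_finite_subgroup N G" and H: "subgroup H G"
  shows "locally_finite_subgroup (N \<inter> H) (G\<lparr>carrier := H\<rparr>)"
  unfolding locally_finite_subgroup_def
proof (intro allI impI)
  fix F assume F: "finite F" "F \<subseteq> N \<inter> H"
  then obtain K where K: "subgroup K G" "finite K" "F \<subseteq> K" "K \<subseteq> N"
    using N unfolding locally_finite_subgroup_def by (meson Int_subset_iff)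
  have "subgroup (K \<inter> H) (G\<lparr>carrier := H\<rparr>)"
    using K(1) H by (intro subgroup_incl subgroups_Inter_pair) auto
  then show "\<exists>K. subgroup K (G\<lparr>carrier := H\<rparr>) \<and> finite K \<and> F \<subseteq> K \<and> K \<subseteq> N \<inter> H"
    using K F by (intro exI[of _ "K \<inter> H"]) auto
qed

text \<open>Permutations with disjoint supports commute because each preserves its own support.  Pointwise, it
  suffices that \<open>v\<close> and its two images avoid the set \<open>D\<close> where the supports may meet.\<close>

lemma commute_outside_common_moved:
  assumes g: "g \<in> Bij V" and f: "f \<in> Bij V" and v: "v \<in> V"
    and D: "moved V g \<inter> moved V f \<subseteq> D" "v \<notin> D" "g v \<notin> D" "f v \<notin> D"
  shows "g (f v) = f (g v)"
proof -
  consider "v \<in> moved V g" | "v \<in> moved V f" | "v \<notin> moved V g" "v \<notin> moved V f" by blast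
  then show ?thesis
  proof cases
    case 1
    then have "v \<notin> moved V f" "g v \<notin> moved V f" using moved_stable[OF g] D by blast+
    then show ?thesis using v Bij_apply[OF g v] by (simp add: moved_def)
  next
    case 2
    then have "v \<notin> moved V g" "f v \<notin> moved V g" using moved_stable[OF f] D by blast+
    then show ?thesis using v Bij_apply[OF f v] by (simp add: moved_def)
  next
    case 3
    then show ?thesis using v by (simp add: moved_def)
  qed
qed

text \<open>The quotient \<open>g f\<^bsup>-1\<^esup>\<close> can move a point only if \<open>g\<close> and \<open>f\<close> differ at its \<open>f\<close>-preimage.\<close>

lemma finitary_quotient_if_agree:
  assumes g: "g \<in> Bij V" and f: "f \<in> Bij V" and D: "finite D"
    and agree: "\<And>v. v \<in> V - D \<Longrightarrow> g v = f v"
  shows "g \<otimes>\<^bsub>BijGroup V\<^esub> inv\<^bsub>BijGroup V\<^esub> f \<in> finitary V"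
proof -
  interpret B: group "BijGroup V" by (rule group_BijGroup)
  have fi: "inv\<^bsub>BijGroup V\<^esub> f \<in> Bij V" using B.inv_closed[of f] f by simp
  have "moved V (g \<otimes>\<^bsub>BijGroup V\<^esub> inv\<^bsub>BijGroup V\<^esub> f) \<subseteq> f ` D"
  proof
    fix v assume "v \<in> moved V (g \<otimes>\<^bsub>BijGroup V\<^esub> inv\<^bsub>BijGroup V\<^esub> f)"
    then have v: "v \<in> V" "g ((inv\<^bsub>BijGroup V\<^esub> f) v) \<noteq> v"
      using g fi by (auto simp: moved_def mult_BijGroup_apply)
    then show "v \<in> f ` D"
      using inv_BijGroup_apply[OF f v(1)] agree[of "(inv\<^bsub>BijGroup V\<^esub> f) v"]
      by (metis DiffI imageI)
  qed
  then have "finite (moved V (g \<otimes>\<^bsub>BijGroup V\<^esub> inv\<^bsub>BijGroup V\<^esub> f))"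
    using D finite_subset by blast
  then show ?thesis using B.m_closed[of g] g fi by (simp add: finitary_def)
qed

section \<open>Commutation in the bubble group up to finitary permutations\<close>

lemma mem_bubble_vertices_iff:
  assumes "\<forall>i\<ge>1. a i \<ge> 1"
  shows "(w, u) \<in> bubble_vertices a b \<longleftrightarrow> w \<in> words b \<and> u < 2 * a (length w + 1)"
proof -
  have "a (length w + 1) \<ge> 1" using assms by simp
  then show ?thesis by (auto simp: bubble_vertices_def)
qed

lemma finite_shallow_vertices: "finite {v \<in> bubble_vertices a b. length (fst v) \<le> N}"
proof (rule finite_subset)
  define B where "B = (\<Sum>i\<le>N. b i)"
  define M where "M = (\<Sum>i\<le>Suc N. 2 * a i)"
  have B: "b i \<le> B" if "i \<le> N" for i
    unfolding B_def using that by (intro member_le_sum) auto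
  have M: "2 * a i \<le> M" if "i \<le> Suc N" for i
    unfolding M_def using that by (intro member_le_sum[of i _ "\<lambda>i. 2 * a i"]) auto
  show "{v \<in> bubble_vertices a b. length (fst v) \<le> N}
      \<subseteq> {w. set w \<subseteq> {..B} \<and> length w \<le> N} \<times> {..M}"
  proof (rule subrelI)
    fix w u assume v: "(w, u) \<in> {v \<in> bubble_vertices a b. length (fst v) \<le> N}"
    then have w: "w \<in> words b" "length w \<le> N" "u \<le> 2 * a (length w + 1) - 1"
      by (auto simp: bubble_vertices_def)
    have "x \<le> B" if x: "x \<in> set w" for x
    proof -
      obtain k where k: "k < length w" "x = w ! k" using x by (metis in_set_conv_nth)
      have "w ! (Suc k - 1) \<in> {1..b (Suc k) - 1}"
        using w(1) k(1) unfolding words_def by fastforce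
      then show ?thesis using k w(2) B[of "Suc k"] by auto
    qed
    then show "(w, u) \<in> {w. set w \<subseteq> {..B} \<and> length w \<le> N} \<times> {..M}"
      using w M[of "length w + 1"] by auto
  qed
  show "finite ({w. set w \<subseteq> {..B} \<and> length w \<le> N} \<times> {..M})"
    by (intro finite_cartesian_product finite_lists_length_le) auto
qed

lemma bubble_alpha_pow_apply:
  assumes a: "\<forall>i\<ge>1. a i \<ge> 1" and v: "(w, u) \<in> bubble_vertices a b"
  shows "(bubble_alpha a b [^]\<^bsub>BijGroup (bubble_vertices a b)\<^esub> (j::nat)) (w, u)
       = (w, (u + j) mod (2 * a (length w + 1)))"
proof -
  interpret B: group "BijGroup (bubble_vertices a b)" by (rule group_BijGroup)
  have alpha: "bubble_alpha a b \<in> Bij (bubble_vertices a b)"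
    using a by (rule bubble_alpha_in_Bij)
  note V = mem_bubble_vertices_iff[OF a]
  have pos: "2 * a (length w + 1) > 0" using v V[of w u b] by linarith
  show ?thesis
  proof (induction j)
    case 0
    then show ?case using v V[of w u b] by (simp add: BijGroup_def)
  next
    case (Suc j)
    let ?p = "bubble_alpha a b [^]\<^bsub>BijGroup (bubble_vertices a b)\<^esub> j"
    have p: "?p \<in> Bij (bubble_vertices a b)" using B.nat_pow_closed[of _ j] alpha by simp
    have in_V: "(w, (u + j) mod (2 * a (length w + 1))) \<in> bubble_vertices a b"
      using v V pos by simp
    have "(bubble_alpha a b [^]\<^bsub>BijGroup (bubble_vertices a b)\<^esub> Suc j) (w, u)
        = (bubble_alpha a b \<otimes>\<^bsub>BijGroup (bubble_vertices a b)\<^esub> ?p) (w, u)"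
      using B.nat_pow_Suc2[of "bubble_alpha a b" j] alpha by simp
    also have "\<dots> = bubble_alpha a b (?p (w, u))"
      using alpha p v by (rule mult_BijGroup_apply)
    also have "\<dots> = (w, ((u + j) mod (2 * a (length w + 1)) + 1) mod (2 * a (length w + 1)))"
      unfolding Suc.IH using in_V by (simp add: bubble_alpha_def)
    finally show ?case by (simp add: mod_simps)
  qed
qed

lemma moved_bubble_beta:
  assumes "(w, u) \<in> moved (bubble_vertices a b) (bubble_beta a b)"
  shows "u = a (length w + 1) \<or> u = 0"
  using assms by (auto simp: moved_def bubble_beta_def split: if_splits)

lemma length_bubble_beta:
  assumes "v \<in> bubble_vertices a b"
  shows "length (fst v) \<le> length (fst (bubble_beta a b v)) + 1"
  using assms by (cases v) (auto simp: bubble_beta_def)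

text \<open>The conjugate \<open>\<alpha>\<^bsup>-j\<^esup> \<beta> \<alpha>\<^sup>j\<close>: it acts like \<open>\<beta>\<close>, but around the vertices \<open>j\<close> steps before the branching
  points of each bubble.  The operations are those of the full permutation group, so that it can be
  evaluated at vertices.\<close>

definition conj_beta :: "(nat \<Rightarrow> nat) \<Rightarrow> (nat \<Rightarrow> nat) \<Rightarrow> nat \<Rightarrow> vertex \<Rightarrow> vertex" where
  "conj_beta a b j =
     inv\<^bsub>BijGroup (bubble_vertices a b)\<^esub> (bubble_alpha a b [^]\<^bsub>BijGroup (bubble_vertices a b)\<^esub> j)
       \<otimes>\<^bsub>BijGroup (bubble_vertices a b)\<^esub> bubble_beta a b
       \<otimes>\<^bsub>BijGroup (bubble_vertices a b)\<^esub> (bubble_alpha a b [^]\<^bsub>BijGroup (bubble_vertices a b)\<^esub> j)"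

context
  fixes a b :: "nat \<Rightarrow> nat"
  assumes a: "\<forall>i\<ge>1. a i \<ge> 1" and b: "\<forall>i\<ge>1. b i \<ge> 2"
begin

private abbreviation (input) "V \<equiv> bubble_vertices a b"

interpretation B: group "BijGroup V" by (rule group_BijGroup)

lemma alpha_pow_Bij: "bubble_alpha a b [^]\<^bsub>BijGroup V\<^esub> (j::nat) \<in> Bij V"
  using B.nat_pow_closed[of "bubble_alpha a b" j] bubble_alpha_in_Bij[OF a] by simp

lemma conj_beta_Bij: "conj_beta a b j \<in> Bij V"
proof -
  have "conj_beta a b j \<in> carrier (BijGroup V)"
    unfolding conj_beta_def
    using alpha_pow_Bij bubble_beta_in_Bij[OF a b]
    by (intro B.m_closed B.inv_closed) simp_all
  then show ?thesis by simp
qed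

lemma conj_beta_apply:
  assumes v: "v \<in> V"
  shows "conj_beta a b j v = (inv\<^bsub>BijGroup V\<^esub> (bubble_alpha a b [^]\<^bsub>BijGroup V\<^esub> j))
      (bubble_beta a b ((bubble_alpha a b [^]\<^bsub>BijGroup V\<^esub> j) v))"
proof -
  have "inv\<^bsub>BijGroup V\<^esub> (bubble_alpha a b [^]\<^bsub>BijGroup V\<^esub> j) \<in> Bij V"
    using B.inv_closed[of "bubble_alpha a b [^]\<^bsub>BijGroup V\<^esub> j"] alpha_pow_Bij by simp
  moreover have "inv\<^bsub>BijGroup V\<^esub> (bubble_alpha a b [^]\<^bsub>BijGroup V\<^esub> j)
      \<otimes>\<^bsub>BijGroup V\<^esub> bubble_beta a b \<in> Bij V"
    using B.m_closed B.inv_closed alpha_pow_Bij bubble_beta_in_Bij[OF a b] by fastforce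
  ultimately show ?thesis
    unfolding conj_beta_def
    using v alpha_pow_Bij bubble_beta_in_Bij[OF a b] by (simp add: mult_BijGroup_apply Bij_apply)
qed

lemma fst_alpha_pow: "v \<in> V \<Longrightarrow> fst ((bubble_alpha a b [^]\<^bsub>BijGroup V\<^esub> (j::nat)) v) = fst v"
  by (cases v) (simp add: bubble_alpha_pow_apply[OF a])

text \<open>A bubble of length \<open>2 * a k\<close> meets branching cycles only at \<open>0\<close> and \<open>a k\<close>, the multiples of \<open>a k\<close>.\<close>

lemma moved_conj_beta_dvd:
  assumes "(w, u) \<in> moved V (conj_beta a b j)"
  shows "a (length w + 1) dvd u + j"
proof -
  let ?p = "bubble_alpha a b [^]\<^bsub>BijGroup V\<^esub> j"
  have v: "(w, u) \<in> V" and ne: "conj_beta a b j (w, u) \<noteq> (w, u)"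
    using assms by (auto simp: moved_def)
  have pv: "?p (w, u) \<in> V" by (rule Bij_apply[OF alpha_pow_Bij v])
  have "bubble_beta a b (?p (w, u)) \<noteq> ?p (w, u)"
    using ne inv_BijGroup_apply(1)[OF alpha_pow_Bij v, of j] by (auto simp: conj_beta_apply[OF v])
  then have "?p (w, u) \<in> moved V (bubble_beta a b)" using pv by (simp add: moved_def)
  then have "(u + j) mod (2 * a (length w + 1)) = a (length w + 1)
      \<or> (u + j) mod (2 * a (length w + 1)) = 0"
    unfolding bubble_alpha_pow_apply[OF a v] by (rule moved_bubble_beta)
  then have "a (length w + 1) dvd (u + j) mod (2 * a (length w + 1))" by auto
  then show ?thesis by (simp add: dvd_mod_iff)
qed

text \<open>Rotating bubbles preserves the word, and a branching cycle joins words whose lengths differ by at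
  most one; so deep vertices stay deep.\<close>

lemma length_conj_beta:
  assumes v: "v \<in> V"
  shows "length (fst v) \<le> length (fst (conj_beta a b j v)) + 1"
proof -
  let ?p = "bubble_alpha a b [^]\<^bsub>BijGroup V\<^esub> j"
  have pv: "?p v \<in> V" by (rule Bij_apply[OF alpha_pow_Bij v])
  have bpv: "bubble_beta a b (?p v) \<in> V" by (rule Bij_apply[OF bubble_beta_in_Bij[OF a b] pv])
  have "fst (conj_beta a b j v) = fst (bubble_beta a b (?p v))"
    using inv_BijGroup_apply[OF alpha_pow_Bij bpv, of j] fst_alpha_pow[of "conj_beta a b j v" j]
    by (simp add: conj_beta_apply[OF v])
  then show ?thesis using length_bubble_beta[OF pv] fst_alpha_pow[OF v, of j] by simp
qed

text \<open>This is where the growth of \<open>a\<close> enters.  The supports meet only on bubbles of half-length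
  \<open>a k\<close> dividing the difference of \<open>i\<close> and \<open>j\<close>, hence only at bounded depth.\<close>

lemma conj_beta_commute_mod_finitary:
  assumes lim: "eventually (\<lambda>n. a n > i + j) sequentially" and ij: "i \<noteq> j"
  shows "(conj_beta a b i \<otimes>\<^bsub>BijGroup V\<^esub> conj_beta a b j) \<otimes>\<^bsub>BijGroup V\<^esub>
    inv\<^bsub>BijGroup V\<^esub> (conj_beta a b j \<otimes>\<^bsub>BijGroup V\<^esub> conj_beta a b i) \<in> finitary V"
proof -
  obtain N where N: "a n > i + j" if "n \<ge> N" for n
    using lim by (auto simp: eventually_sequentially)
  define D where "D k = {v \<in> V. length (fst v) \<le> k}" for k
  have common: "moved V (conj_beta a b i) \<inter> moved V (conj_beta a b j) \<subseteq> D N"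
  proof (rule subrelI)
    fix w u assume "(w, u) \<in> moved V (conj_beta a b i) \<inter> moved V (conj_beta a b j)"
    then have m: "(w, u) \<in> moved V (conj_beta a b i)" "(w, u) \<in> moved V (conj_beta a b j)"
      by auto
    have d: "a (length w + 1) dvd u + i" "a (length w + 1) dvd u + j"
      using moved_conj_beta_dvd[OF m(1)] moved_conj_beta_dvd[OF m(2)] by auto
    have "a (length w + 1) \<le> i + j"
    proof (cases "i < j")
      case True
      have "a (length w + 1) dvd (u + j) - (u + i)" using d(2,1) by (rule dvd_diff_nat)
      then have "a (length w + 1) \<le> j - i" using True by (intro dvd_imp_le) auto
      then show ?thesis by simp
    next
      case False
      have "a (length w + 1) dvd (u + i) - (u + j)" using d by (rule dvd_diff_nat)
      then have "a (length w + 1) \<le> i - j" using False ij by (intro dvd_imp_le) auto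
      then show ?thesis by simp
    qed
    then have "length w \<le> N" using N[of "length w + 1"] by (cases "length w \<le> N") auto
    then show "(w, u) \<in> D N" using m by (simp add: D_def moved_def)
  qed
  have gf: "conj_beta a b i \<otimes>\<^bsub>BijGroup V\<^esub> conj_beta a b j \<in> Bij V"
    and fg: "conj_beta a b j \<otimes>\<^bsub>BijGroup V\<^esub> conj_beta a b i \<in> Bij V"
    using B.m_closed[of "conj_beta a b i" "conj_beta a b j"]
      B.m_closed[of "conj_beta a b j" "conj_beta a b i"] conj_beta_Bij by simp_all
  show ?thesis
  proof (rule finitary_quotient_if_agree[OF gf fg])
    \<comment> \<open>One level more than the common support reaches, since the conjugates may move a vertex up by one.\<close>
    show "finite (D (N + 1))" unfolding D_def by (rule finite_shallow_vertices)
    fix v assume v: "v \<in> V - D (N + 1)"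
    have deep: "conj_beta a b k v \<notin> D N" for k
      using length_conj_beta[of v k] v by (auto simp: D_def)
    have "conj_beta a b i (conj_beta a b j v) = conj_beta a b j (conj_beta a b i v)"
      using v by (intro commute_outside_common_moved[OF _ _ _ common] conj_beta_Bij deep)
        (auto simp: D_def)
    then show "(conj_beta a b i \<otimes>\<^bsub>BijGroup V\<^esub> conj_beta a b j) v
        = (conj_beta a b j \<otimes>\<^bsub>BijGroup V\<^esub> conj_beta a b i) v"
      using v conj_beta_Bij by (simp add: mult_BijGroup_apply)
  qed
qed

end

section \<open>Amenability of bubble groups\<close>

theorem proposition5p13:
  fixes a b :: "nat \<Rightarrow> nat"
  assumes "\<forall>i\<ge>1. a i \<ge> 1"
    and "liminf (\<lambda>n. ereal (real (a n))) = \<infinity>"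
    and "\<forall>i\<ge>1. b i \<ge> 2"
  shows "amenable (bubble_group a b)"
proof -
  note a = assms(1) and b = assms(3)
  define V where "V = bubble_vertices a b"
  define H where "H = generate (BijGroup V) {bubble_alpha a b, bubble_beta a b}"
  define G where "G = (BijGroup V)\<lparr>carrier := H\<rparr>"
  define N where "N = finitary V \<inter> H"
  let ?x = "bubble_alpha a b" and ?y = "bubble_beta a b"
  interpret B: group "BijGroup V" by (rule group_BijGroup)
  have xy: "{?x, ?y} \<subseteq> carrier (BijGroup V)"
    using bubble_alpha_in_Bij[OF a] bubble_beta_in_Bij[OF a b] by (simp add: V_def)
  have sub: "subgroup H (BijGroup V)"
    unfolding H_def using xy by (rule B.generate_is_subgroup)
  interpret G: group G unfolding G_def using sub by (rule B.subgroup_imp_group)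
  have xyH: "?x \<in> H" "?y \<in> H" by (auto simp: H_def intro: generate.incl)
  have gen: "carrier G = generate G {?x, ?y}"
    using B.generate_consistent[OF _ sub, of "{?x, ?y}"] xyH by (simp add: G_def H_def)
  have normal: "N \<lhd> G"
    using B.normal_Int_subgroup[OF sub finitary_normal] by (simp only: N_def G_def)
  note sub_N = normal_imp_subgroup[OF normal]
  have q: "group_hom G (G Mod N) (\<lambda>g. N #>\<^bsub>G\<^esub> g)"
    by (rule group_hom.intro[OF G.group_axioms normal.factorgroup_is_group[OF normal]
          group_hom_axioms.intro[OF normal.r_coset_hom_Mod[OF normal]]])
  have ker: "kernel G (G Mod N) (\<lambda>g. N #>\<^bsub>G\<^esub> g) = N"
    using G.coset_join1 G.coset_join2 sub_N subgroup.subset[OF sub_N] by (auto simp: kernel_def)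
  have lf: "locally_finite_subgroup (kernel G (G Mod N) (\<lambda>g. N #>\<^bsub>G\<^esub> g)) G"
    unfolding ker unfolding N_def G_def
    using locally_finite_finitary sub by (rule B.locally_finite_subgroup_Int)
  have pow: "?x [^]\<^bsub>G\<^esub> j = ?x [^]\<^bsub>BijGroup V\<^esub> j" for j :: nat
    unfolding G_def by (rule B.nat_pow_consistent[symmetric])
  have pow_H: "?x [^]\<^bsub>BijGroup V\<^esub> j \<in> H" for j :: nat
    using G.nat_pow_closed[of ?x j] xyH pow by (simp add: G_def)
  have conj: "conj_beta a b j = inv\<^bsub>G\<^esub> (?x [^]\<^bsub>G\<^esub> j) \<otimes>\<^bsub>G\<^esub> ?y \<otimes>\<^bsub>G\<^esub> ?x [^]\<^bsub>G\<^esub> j" for j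
    unfolding pow using B.m_inv_consistent[OF sub pow_H]
    by (simp add: conj_beta_def V_def G_def)
  have conj_car: "conj_beta a b j \<in> carrier G" for j
    unfolding conj using xyH by (intro G.m_closed G.inv_closed G.nat_pow_closed) (simp_all add: G_def)
  have lim: "eventually (\<lambda>n. a n > k) sequentially" for k
  proof -
    have "\<infinity> \<le> liminf (\<lambda>n. ereal (real (a n)))" using assms(2) by simp
    then have "eventually (\<lambda>n. ereal (real k) < ereal (real (a n))) sequentially"
      unfolding le_Liminf_iff by (elim allE[of _ "ereal (real k)"]) simp
    then show ?thesis by simp
  qed
  have comm: "N #>\<^bsub>G\<^esub> (conj_beta a b i \<otimes>\<^bsub>G\<^esub> conj_beta a b j)
      = N #>\<^bsub>G\<^esub> (conj_beta a b j \<otimes>\<^bsub>G\<^esub> conj_beta a b i)" for i j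
  proof (cases "i = j")
    case False
    let ?g = "conj_beta a b i \<otimes>\<^bsub>G\<^esub> conj_beta a b j"
    let ?f = "conj_beta a b j \<otimes>\<^bsub>G\<^esub> conj_beta a b i"
    have car: "?g \<in> carrier G" "?f \<in> carrier G" using conj_car by simp_all
    have "?g \<otimes>\<^bsub>G\<^esub> inv\<^bsub>G\<^esub> ?f \<in> finitary V"
      using conj_beta_commute_mod_finitary[OF a b lim False] B.m_inv_consistent[OF sub, of ?f] car
      by (simp add: V_def G_def)
    moreover have "?g \<otimes>\<^bsub>G\<^esub> inv\<^bsub>G\<^esub> ?f \<in> H"
      using G.m_closed[OF car(1) G.inv_closed[OF car(2)]] by (simp add: G_def)
    ultimately have "?g \<in> N #>\<^bsub>G\<^esub> ?f"
      using car by (intro subgroup.rcos_module_rev[OF sub_N] G.group_axioms) (simp_all add: N_def)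
    then show ?thesis
      using G.repr_independence[OF _ car(2) sub_N] by simp
  qed simp
  have "amenable G"
  proof (rule group_hom.amenable_if_conjugates_commute[OF q _ _ gen lf])
    show "?x \<in> carrier G" "?y \<in> carrier G" using xyH by (simp_all add: G_def)
    show "conj_beta a b j = inv\<^bsub>G\<^esub> (?x [^]\<^bsub>G\<^esub> j) \<otimes>\<^bsub>G\<^esub> ?y \<otimes>\<^bsub>G\<^esub> ?x [^]\<^bsub>G\<^esub> j" for j
      by (rule conj)
    show "N #>\<^bsub>G\<^esub> (conj_beta a b i \<otimes>\<^bsub>G\<^esub> conj_beta a b j)
        = N #>\<^bsub>G\<^esub> (conj_beta a b j \<otimes>\<^bsub>G\<^esub> conj_beta a b i)" for i j
      by (rule comm)
  qed
  then show ?thesis by (simp add: bubble_group_def G_def H_def V_def)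
qed

end
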